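(* Suppose the likelihood ratio $\mathrm{LR}$ has finite variation, that $\mathrm{LR}$ and $F$ are non-differentiable at only finitely many points, and that for every $t\in[0,T]$ the finite partition condition on $\frac{\partial\phi_\lambda}{\partial y}(t,\cdot)$ stated in the context (Assumption A3) holds. If the cumulative distribution function $F$ of $Y$ is strictly increasing and $\mathrm{LR}$ is piecewise $C^1$, then the optimal indemnity function $I^*(t,y)$ is unique (for each $t\in[0,T]$ there is exactly one $I^*(t,\cdot)\in\mathcal C$ attaining $\inf_{I\in\mathcal C}H(t,I)$) and $I^*(t,y)$ is continuous in $t\in[0,T]$.
   Context: Constants: $T>0$, $r>0$, $\gamma>0$, $\theta\ge 0$. $Y$ is a nonnegative random variable (claim size; point masses, e.g. at zero, are allowed) considered under two probability measures $\mathbb P$ (insurer) and $\mathbb Q$ (reinsurer), with finite first and second moments under both. $F$ and $F^{\mathbb Q}$ are the distribution functions of $Y$ under $\mathbb P$ and $\mathbb Q$; $\mathbb E$ is expectation under $\mathbb P$, $\mathbb E^{\mathbb Q}$ under $\mathbb Q$. $\mathcal C:=\{f:\mathbb R_+\to\mathbb R_+ \mid f(0)=0,\ 0\le f(y)-f(x)\le y-x\ \text{for all } x\le y\}$. $H(t,I):=(1+\theta)\mathbb E^{\mathbb Q}[I(Y)]+\mathbb E[Y-I(Y)]+\dfrac{\gamma e^{r(T-t)}}{2}\mathbb E[(Y-I(Y))^2]$ for $I\in\mathcal C$. The optimal indemnity function (equilibrium reinsurance strategy of the insurer's dynamic mean-variance problem) is the family $I^*(t,\cdot)\in\mathcal C$,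 $t\in[0,T]$, such that for each $t$, $I^*(t,\cdot)$ attains $\inf_{I\in\mathcal C}H(t,I)$; this is the optimality condition arising from the extended HJB system of the mean-variance problem. A Borel function $\mathrm{LR}\ge 0$ is a likelihood ratio of $\mathbb Q$ against $\mathbb P$ if $\mathbb Q(Y\in E\cap\{\mathrm{LR}<\infty\})=\int_E \mathrm{LR}(y)\,dF(y)$ for all Borel $E$. $\phi_\lambda(t,y):=y+\dfrac{\lambda-(1+\theta)\mathrm{LR}(y)}{\gamma e^{r(T-t)}}$ for $\lambda\in\mathbb R$; $\partial\phi_\lambda/\partial y$ does not depend on $\lambda$. Assumption A3: let $0=y_0'\le y_1'<\cdots<y_n'<\infty$ where $y_1',\dots,y_n'$ are the points of non-differentiability of $\mathrm{LR}$ or $F$. For any $t\in[0,T]$, each interval $(y'_{i-1},y'_i)$, $i=1,\dots,n$, and $(y'_n,\infty)$ can be partitioned into finitely many disjoint sub-intervals on each of which one of the following holds throughout: $\frac{\partial\phi_\lambda}{\partial y}(t,y)>1$; $\frac{\partial\phi_\lambda}{\partial y}(t,y)\in[0,1]$; $\frac{\partial\phi_\lambda}{\partial y}(t,y)<0$. *)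

theory Defs
  imports "HOL-Probability.Probability"
begin

text \<open>Functions on the half-line are encoded as extensional functions on \<^term>\<open>{0::real..}\<close>,
  so that equality of indemnities is ordinary equality.\<close>

definition indemnities :: "(real \<Rightarrow> real) set" where
  "indemnities = {f \<in> {0..} \<rightarrow>\<^sub>E {0..}. f 0 = 0 \<and>
     (\<forall>x y. 0 \<le> x \<and> x \<le> y \<longrightarrow> 0 \<le> f y - f x \<and> f y - f x \<le> y - x)}"

definition objective ::
    "'a measure \<Rightarrow> 'a measure \<Rightarrow> ('a \<Rightarrow> real) \<Rightarrow> real \<Rightarrow> real \<Rightarrow> real \<Rightarrow> real
      \<Rightarrow> real \<Rightarrow> (real \<Rightarrow> real) \<Rightarrow> real" where
  "objective P Q Y T r \<gamma> \<theta> t I =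
     (1 + \<theta>) * (\<integral>\<omega>. I (Y \<omega>) \<partial>Q) + (\<integral>\<omega>. Y \<omega> - I (Y \<omega>) \<partial>P)
     + \<gamma> * exp (r * (T - t)) / 2 * (\<integral>\<omega>. (Y \<omega> - I (Y \<omega>))\<^sup>2 \<partial>P)"

definition optimal_indemnity ::
    "'a measure \<Rightarrow> 'a measure \<Rightarrow> ('a \<Rightarrow> real) \<Rightarrow> real \<Rightarrow> real \<Rightarrow> real \<Rightarrow> real
      \<Rightarrow> real \<Rightarrow> (real \<Rightarrow> real) \<Rightarrow> bool" where
  "optimal_indemnity P Q Y T r \<gamma> \<theta> t I \<longleftrightarrow> I \<in> indemnities \<and>
     (\<forall>J\<in>indemnities. objective P Q Y T r \<gamma> \<theta> t I \<le> objective P Q Y T r \<gamma> \<theta> t J)"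

text \<open>The likelihood ratio may be infinite, because \<open>Q\<close> need not be absolutely continuous with
  respect to \<open>P\<close>. Its values at negative arguments are irrelevant throughout.\<close>

definition likelihood_ratio ::
    "'a measure \<Rightarrow> 'a measure \<Rightarrow> ('a \<Rightarrow> real) \<Rightarrow> (real \<Rightarrow> ennreal) \<Rightarrow> bool" where
  "likelihood_ratio P Q Y LR \<longleftrightarrow> LR \<in> borel_measurable borel \<and>
     (\<forall>E\<in>sets borel. emeasure Q {\<omega> \<in> space Q. Y \<omega> \<in> E \<and> LR (Y \<omega>) < \<infinity>}
        = (\<integral>\<^sup>+y\<in>E. LR y \<partial>distr P borel Y))"

text \<open>Finite variation on every compact interval, the variation being taken over the points where
  the function is finite. This is implied by finite total variation on the half-line.\<close>

definition bounded_variation_on :: "(real \<Rightarrow> real) \<Rightarrow> real set \<Rightarrow> bool" where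
  "bounded_variation_on g S \<longleftrightarrow> (\<exists>M. \<forall>xs. sorted xs \<and> set xs \<subseteq> S \<longrightarrow>
     (\<Sum>i<length xs - 1. \<bar>g (xs ! Suc i) - g (xs ! i)\<bar>) \<le> M)"

definition finite_variation :: "(real \<Rightarrow> ennreal) \<Rightarrow> bool" where
  "finite_variation f \<longleftrightarrow>
     (\<forall>b\<ge>0. bounded_variation_on (\<lambda>y. enn2real (f y)) {y \<in> {0..b}. f y < \<infinity>})"

text \<open>At \<open>0\<close> differentiability is one-sided. A point near which the likelihood ratio takes the value
  \<open>\<infinity>\<close> counts as a point of non-differentiability.\<close>

definition differentiable_at_point :: "(real \<Rightarrow> ennreal) \<Rightarrow> real \<Rightarrow> bool" where
  "differentiable_at_point f y \<longleftrightarrow>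
     f y < \<infinity> \<and> (\<forall>\<^sub>F x in at y within {0..}. f x < \<infinity>) \<and>
     (\<lambda>x. enn2real (f x)) differentiable (at y within {0..})"

definition nondiff_points :: "(real \<Rightarrow> ennreal) \<Rightarrow> (real \<Rightarrow> real) \<Rightarrow> real set" where
  "nondiff_points LR F =
     {y \<in> {0..}. \<not> differentiable_at_point LR y \<or> \<not> F differentiable (at y within {0..})}"

text \<open>Jumps are allowed at the finitely many break points.\<close>

definition piecewise_C1 :: "(real \<Rightarrow> ennreal) \<Rightarrow> bool" where
  "piecewise_C1 f \<longleftrightarrow> (\<exists>S. finite S \<and> (\<forall>y\<in>{0<..} - S. f y < \<infinity>) \<and>
     (\<lambda>y. enn2real (f y)) C1_differentiable_on ({0<..} - S))"

text \<open>Only differentiated at points where the likelihood ratio is differentiable, hence finite; there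
  the conversion to reals is harmless.\<close>

definition phi ::
    "real \<Rightarrow> real \<Rightarrow> real \<Rightarrow> real \<Rightarrow> (real \<Rightarrow> ennreal) \<Rightarrow> real \<Rightarrow> real \<Rightarrow> real \<Rightarrow> real" where
  "phi T r \<gamma> \<theta> LR l t y =
     y + (l - (1 + \<theta>) * enn2real (LR y)) / (\<gamma> * exp (r * (T - t)))"

definition finitely_partitioned :: "(real \<Rightarrow> real) \<Rightarrow> real set \<Rightarrow> bool" where
  "finitely_partitioned d J \<longleftrightarrow> (\<exists>\<K>. finite \<K> \<and> partition_on J \<K> \<and>
     (\<forall>K\<in>\<K>. is_interval K \<and>
        ((\<forall>y\<in>K. d y > 1) \<or> (\<forall>y\<in>K. d y \<in> {0..1}) \<or> (\<forall>y\<in>K. d y < 0))))"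

text \<open>Only \<open>y' 1, \<dots>, y' n\<close> are points of non-differentiability; \<open>y' 0 = 0\<close> is a
  left end point and may coincide with \<open>y' 1\<close>.\<close>

definition nondiff_enumeration ::
    "(real \<Rightarrow> ennreal) \<Rightarrow> (real \<Rightarrow> real) \<Rightarrow> nat \<Rightarrow> (nat \<Rightarrow> real) \<Rightarrow> bool" where
  "nondiff_enumeration LR F n y' \<longleftrightarrow>
     y' 0 = 0 \<and> strict_mono_on {1..n} y' \<and> y' ` {1..n} = nondiff_points LR F"

definition partition_condition ::
    "real \<Rightarrow> real \<Rightarrow> real \<Rightarrow> real \<Rightarrow> (real \<Rightarrow> ennreal) \<Rightarrow> nat \<Rightarrow> (nat \<Rightarrow> real) \<Rightarrow> bool" where
  "partition_condition T r \<gamma> \<theta> LR n y' \<longleftrightarrow>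
     (\<forall>t\<in>{0..T}. \<forall>l.
        (\<forall>i\<in>{1..n}. finitely_partitioned (deriv (phi T r \<gamma> \<theta> LR l t)) {y' (i - 1)<..<y' i}) \<and>
        finitely_partitioned (deriv (phi T r \<gamma> \<theta> LR l t)) {y' n<..})"

end

theory Submission
  imports Defs
begin

text \<open>The objective is an affine functional of the indemnity plus a positive multiple of
  \<open>E[(Y - I(Y))\<^sup>2]\<close>, so it is uniformly convex with respect to the distance of
  \<open>I(Y)\<close> and \<open>J(Y)\<close> in \<open>L\<^sup>2(P)\<close>, and averaging two indemnities gives an indemnity. The
  parallelogram identity therefore bounds \<open>E[(I(Y) - J(Y))\<^sup>2]\<close> by a multiple of the amount by which \<open>I\<close> and \<open>J\<close>
  fail to be optimal (\<open>near_optimal_close\<close>), exactly as in the projection theorem for Hilbert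
  spaces.

  Closeness in \<open>L\<^sup>2(P)\<close> is turned into closeness at every single point by the Lipschitz condition:
  if \<open>I\<close> and \<open>J\<close> differ at \<open>y\<close> by \<open>e\<close>, they differ by at least \<open>e / 2\<close> on \<open>{y<..y + e / 2}\<close>, and
  this interval carries positive mass because the distribution function is strictly increasing
  (\<open>mean_square_close_imp_close\<close>).

  All claims follow from these two facts. Two optimal indemnities have mean-square distance zero and
  hence agree everywhere. A minimising sequence is Cauchy at every point; its pointwise limit is an
  indemnity, and the objective converges along the sequence by dominated convergence, with \<open>Y\<close>
  and its square as dominating functions. Finally, changing \<open>t\<close> changes only the coefficient of the
  quadratic term, so the optimal indemnity for \<open>s\<close> is nearly optimal for \<open>t\<close> when \<open>s\<close> is close to
  \<open>t\<close>, which gives continuity in \<open>t\<close>.\<close>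

section \<open>Indemnities\<close>

lemma indemnities_bounds:
  assumes "I \<in> indemnities" "0 \<le> y"
  shows "0 \<le> I y" "I y \<le> y"
proof -
  have "I 0 = 0" "0 \<le> I y - I 0 \<and> I y - I 0 \<le> y - 0"
    using assms unfolding indemnities_def by blast+
  then show "0 \<le> I y" "I y \<le> y" by simp_all
qed

lemma indemnities_increment:
  assumes "I \<in> indemnities" "0 \<le> x" "x \<le> y"
  shows "I x \<le> I y" "I y - I x \<le> y - x"
  using assms by (auto simp: indemnities_def)

text \<open>Both increments lie in \<open>{0..y - x}\<close>, so the Lipschitz constant of the difference is one
  rather than two.\<close>

lemma indemnities_diff_increment:
  assumes "I \<in> indemnities" "J \<in> indemnities" "0 \<le> x" "x \<le> y"
  shows "\<bar>(I y - J y) - (I x - J x)\<bar> \<le> y - x"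
  using indemnities_increment[OF assms(1,3,4)] indemnities_increment[OF assms(2,3,4)] by linarith

lemma indemnities_eqI:
  assumes "I \<in> indemnities" "J \<in> indemnities" "\<And>y. 0 \<le> y \<Longrightarrow> I y = J y"
  shows "I = J"
proof (rule PiE_ext)
  show "I \<in> {0..} \<rightarrow>\<^sub>E {0..}" "J \<in> {0..} \<rightarrow>\<^sub>E {0..}"
    using assms(1,2) by (simp_all add: indemnities_def)
qed (use assms(3) in auto)

lemma full_retention_indemnity: "(\<lambda>y\<in>{0..}. 0) \<in> indemnities"
  by (auto simp: indemnities_def)

lemma midpoint_indemnity:
  assumes "I \<in> indemnities" "J \<in> indemnities"
  shows "(\<lambda>y\<in>{0..}. (I y + J y) / 2) \<in> indemnities"
proof -
  have "0 \<le> (I y + J y) / 2 - (I x + J x) / 2 \<and> (I y + J y) / 2 - (I x + J x) / 2 \<le> y - x"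
    if "0 \<le> x" "x \<le> y" for x y
    using indemnities_increment[OF assms(1) that] indemnities_increment[OF assms(2) that]
    by (auto simp: field_simps)
  moreover have "I 0 = 0" "J 0 = 0"
    using assms by (auto simp: indemnities_def)
  ultimately show ?thesis
    using indemnities_bounds(1)[OF assms(1)] indemnities_bounds(1)[OF assms(2)]
    by (auto simp: indemnities_def)
qed

lemma pointwise_limit_indemnity:
  assumes "\<And>k. I k \<in> indemnities" and lim: "\<And>y. 0 \<le> y \<Longrightarrow> (\<lambda>k. I k y) \<longlonglongrightarrow> L y"
  shows "(\<lambda>y\<in>{0..}. L y) \<in> indemnities"
proof -
  have "0 \<le> L y" if "0 \<le> y" for y
    by (rule LIMSEQ_le_const[OF lim[OF that]]) (use indemnities_bounds(1)[OF assms(1) that] in auto)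
  moreover have "L 0 = 0"
  proof -
    have "I k 0 = 0" for k
      using assms(1) by (simp add: indemnities_def)
    then show ?thesis
      using lim[of 0] by (simp add: LIMSEQ_const_iff)
  qed
  moreover have "0 \<le> L y - L x \<and> L y - L x \<le> y - x" if "0 \<le> x" "x \<le> y" for x y
  proof -
    have conv: "(\<lambda>k. I k y - I k x) \<longlonglongrightarrow> L y - L x"
      using that by (intro tendsto_diff lim) auto
    show ?thesis
      using indemnities_increment[OF assms(1) that]
      by (intro conjI LIMSEQ_le_const[OF conv] LIMSEQ_le_const2[OF conv]) auto
  qed
  ultimately show ?thesis
    by (auto simp: indemnities_def)
qed

lemma borel_measurable_indemnity:
  assumes I: "I \<in> indemnities" and Y: "Y \<in> borel_measurable M" and "\<forall>\<omega>\<in>space M. 0 \<le> Y \<omega>"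
  shows "(\<lambda>\<omega>. I (Y \<omega>)) \<in> borel_measurable M"
proof -
  \<comment> \<open>An indemnity is unspecified below \<open>0\<close>; freezing it there makes it monotone on the whole line.\<close>
  have "mono (\<lambda>y. I (max 0 y))"
    using indemnities_increment(1)[OF I] by (intro monoI) (simp add: max_def)
  then have "(\<lambda>\<omega>. I (max 0 (Y \<omega>))) \<in> borel_measurable M"
    using Y by (rule measurable_compose[OF _ borel_measurable_mono, rotated])
  then show ?thesis
    by (rule measurable_cong[THEN iffD1, rotated]) (use assms(3) in \<open>auto simp: max_def\<close>)
qed

section \<open>The objective as a uniformly convex functional\<close>

locale reinsurance = P: prob_space P + Q: prob_space Q
  for P Q :: "'a measure" +
  fixes Y :: "'a \<Rightarrow> real" and T r \<gamma> \<theta> :: real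
  assumes gamma_pos: "0 < \<gamma>" and theta_nonneg: "0 \<le> \<theta>"
    and sets_eq: "sets Q = sets P"
    and Y_measurable [measurable]: "Y \<in> borel_measurable P"
    and Y_nonneg: "\<forall>\<omega>\<in>space P. 0 \<le> Y \<omega>"
    and Y_integrable_P: "integrable P Y"
    and Y_square_integrable: "integrable P (\<lambda>\<omega>. (Y \<omega>)\<^sup>2)"
    and Y_integrable_Q: "integrable Q Y"
    and cdf_strict: "strict_mono_on {0..} (cdf (distr P borel Y))"
begin

abbreviation H :: "real \<Rightarrow> (real \<Rightarrow> real) \<Rightarrow> real" where
  "H \<equiv> objective P Q Y T r \<gamma> \<theta>"

abbreviation optimal :: "real \<Rightarrow> (real \<Rightarrow> real) \<Rightarrow> bool" where
  "optimal \<equiv> optimal_indemnity P Q Y T r \<gamma> \<theta>"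

definition risk_weight :: "real \<Rightarrow> real" where
  "risk_weight t = \<gamma> * exp (r * (T - t))"

definition retained_square :: "(real \<Rightarrow> real) \<Rightarrow> real" where
  "retained_square I = (\<integral>\<omega>. (Y \<omega> - I (Y \<omega>))\<^sup>2 \<partial>P)"

definition mean_square_dist :: "(real \<Rightarrow> real) \<Rightarrow> (real \<Rightarrow> real) \<Rightarrow> real" where
  "mean_square_dist I J = (\<integral>\<omega>. (I (Y \<omega>) - J (Y \<omega>))\<^sup>2 \<partial>P)"

lemma risk_weight_pos: "0 < risk_weight t"
  using gamma_pos by (simp add: risk_weight_def)

lemma space_eq: "space Q = space P"
  by (rule sets_eq_imp_space_eq[OF sets_eq])

lemma indemnity_measurable_P [measurable]:
  "I \<in> indemnities \<Longrightarrow> (\<lambda>\<omega>. I (Y \<omega>)) \<in> borel_measurable P"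
  by (rule borel_measurable_indemnity[OF _ Y_measurable Y_nonneg])

lemma indemnity_measurable_Q:
  "I \<in> indemnities \<Longrightarrow> (\<lambda>\<omega>. I (Y \<omega>)) \<in> borel_measurable Q"
  using indemnity_measurable_P by (simp cong: measurable_cong_sets add: sets_eq)

lemma indemnity_integrable_P:
  assumes "I \<in> indemnities" shows "integrable P (\<lambda>\<omega>. I (Y \<omega>))"
  by (rule Bochner_Integration.integrable_bound[OF Y_integrable_P])
    (use assms Y_nonneg indemnities_bounds[OF assms] in auto)

lemma indemnity_integrable_Q:
  assumes "I \<in> indemnities" shows "integrable Q (\<lambda>\<omega>. I (Y \<omega>))"
  by (rule Bochner_Integration.integrable_bound[OF Y_integrable_Q])
    (use assms Y_nonneg indemnities_bounds[OF assms] indemnity_measurable_Q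
      in \<open>auto simp: space_eq\<close>)

lemma retained_square_le:
  assumes "I \<in> indemnities" "\<omega> \<in> space P"
  shows "(Y \<omega> - I (Y \<omega>))\<^sup>2 \<le> (Y \<omega>)\<^sup>2"
  using Y_nonneg assms indemnities_bounds[OF assms(1), of "Y \<omega>"] by (intro power_mono) auto

lemma square_diff_le:
  assumes "I \<in> indemnities" "J \<in> indemnities" "\<omega> \<in> space P"
  shows "(I (Y \<omega>) - J (Y \<omega>))\<^sup>2 \<le> (Y \<omega>)\<^sup>2"
proof -
  have "\<bar>I (Y \<omega>) - J (Y \<omega>)\<bar> \<le> \<bar>Y \<omega>\<bar>"
    using Y_nonneg assms indemnities_bounds[OF assms(1), of "Y \<omega>"]
      indemnities_bounds[OF assms(2), of "Y \<omega>"] by fastforce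
  then show ?thesis by (simp add: abs_le_square_iff)
qed

lemma retained_square_integrable:
  assumes "I \<in> indemnities" shows "integrable P (\<lambda>\<omega>. (Y \<omega> - I (Y \<omega>))\<^sup>2)"
  by (rule Bochner_Integration.integrable_bound[OF Y_square_integrable])
    (use assms retained_square_le[OF assms] in auto)

lemma square_diff_integrable:
  assumes "I \<in> indemnities" "J \<in> indemnities"
  shows "integrable P (\<lambda>\<omega>. (I (Y \<omega>) - J (Y \<omega>))\<^sup>2)"
  by (rule Bochner_Integration.integrable_bound[OF Y_square_integrable])
    (use assms square_diff_le[OF assms] in auto)

lemma objective_eq:
  assumes "I \<in> indemnities"
  shows "H t I = (1 + \<theta>) * (\<integral>\<omega>. I (Y \<omega>) \<partial>Q) + ((\<integral>\<omega>. Y \<omega> \<partial>P) - (\<integral>\<omega>. I (Y \<omega>) \<partial>P))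
    + risk_weight t / 2 * retained_square I"
  using assms
  by (simp add: objective_def risk_weight_def retained_square_def Y_integrable_P
      indemnity_integrable_P)

lemma objective_nonneg:
  assumes "I \<in> indemnities" shows "0 \<le> H t I"
proof -
  have "0 \<le> (\<integral>\<omega>. I (Y \<omega>) \<partial>Q)" "0 \<le> (\<integral>\<omega>. Y \<omega> - I (Y \<omega>) \<partial>P)"
    using Y_nonneg indemnities_bounds[OF assms]
    by (auto intro!: Bochner_Integration.integral_nonneg simp: space_eq)
  then show ?thesis
    using gamma_pos theta_nonneg by (auto simp: objective_def)
qed

text \<open>The affine part of the objective at the midpoint is the average of its values at \<open>I\<close> and \<open>J\<close>; the quadratic
  part obeys the parallelogram identity, which leaves the surplus on the right.\<close>

lemma objective_midpoint:
  assumes "I \<in> indemnities" "J \<in> indemnities"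
  shows "2 * H t (\<lambda>y\<in>{0..}. (I y + J y) / 2)
    = H t I + H t J - risk_weight t / 4 * mean_square_dist I J"
proof -
  let ?M = "\<lambda>y\<in>{0..}. (I y + J y) / 2"
  note int = indemnity_integrable_P[OF assms(1)] indemnity_integrable_P[OF assms(2)]
    indemnity_integrable_Q[OF assms(1)] indemnity_integrable_Q[OF assms(2)]
    retained_square_integrable[OF assms(1)] retained_square_integrable[OF assms(2)]
    square_diff_integrable[OF assms]
  have M: "?M (Y \<omega>) = (I (Y \<omega>) + J (Y \<omega>)) / 2" if "\<omega> \<in> space P" for \<omega>
    using that Y_nonneg by simp
  have P: "(\<integral>\<omega>. ?M (Y \<omega>) \<partial>P) = ((\<integral>\<omega>. I (Y \<omega>) \<partial>P) + (\<integral>\<omega>. J (Y \<omega>) \<partial>P)) / 2"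
    using int by (subst Bochner_Integration.integral_cong[OF refl M]) auto
  have Q: "(\<integral>\<omega>. ?M (Y \<omega>) \<partial>Q) = ((\<integral>\<omega>. I (Y \<omega>) \<partial>Q) + (\<integral>\<omega>. J (Y \<omega>) \<partial>Q)) / 2"
    using int by (subst Bochner_Integration.integral_cong[OF refl M]) (auto simp: space_eq)
  have "retained_square ?M = (\<integral>\<omega>. (Y \<omega> - I (Y \<omega>))\<^sup>2 / 2 + (Y \<omega> - J (Y \<omega>))\<^sup>2 / 2
      - (I (Y \<omega>) - J (Y \<omega>))\<^sup>2 / 4 \<partial>P)"
    unfolding retained_square_def
    by (intro Bochner_Integration.integral_cong refl, subst M)
      (auto simp: power2_eq_square field_simps)
  also have "\<dots> = retained_square I / 2 + retained_square J / 2 - mean_square_dist I J / 4"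
    using int by (simp add: retained_square_def mean_square_dist_def)
  finally have S: "retained_square ?M = \<dots>" .
  show ?thesis
    unfolding objective_eq[OF assms(1)] objective_eq[OF assms(2)]
      objective_eq[OF midpoint_indemnity[OF assms]] P Q S
    by (simp add: field_simps)
qed

text \<open>The midpoint of \<open>I\<close> and \<open>J\<close> cannot beat a lower bound \<open>m\<close> of the objective.\<close>

lemma near_optimal_close:
  assumes "I \<in> indemnities" "J \<in> indemnities" and "\<And>K. K \<in> indemnities \<Longrightarrow> m \<le> H t K"
  shows "risk_weight t / 4 * mean_square_dist I J \<le> (H t I - m) + (H t J - m)"
  using objective_midpoint[OF assms(1,2), of t] assms(3)[OF midpoint_indemnity[OF assms(1,2)]]
  by linarith

section \<open>From mean-square closeness to pointwise closeness\<close>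

text \<open>Full support of the claim distribution on the half-line.\<close>

lemma prob_interval_pos:
  assumes "0 \<le> a" "a < b"
  shows "0 < P.prob {\<omega> \<in> space P. a < Y \<omega> \<and> Y \<omega> \<le> b}"
proof -
  interpret D: real_distribution "distr P borel Y"
    by (intro P.real_distribution_distr) simp
  have "0 < cdf (distr P borel Y) b - cdf (distr P borel Y) a"
    using strict_mono_onD[OF cdf_strict, of a b] assms by simp
  also have "\<dots> = P.prob (Y -` {a<..b} \<inter> space P)"
    using assms by (simp add: D.cdf_diff_eq measure_distr)
  also have "Y -` {a<..b} \<inter> space P = {\<omega> \<in> space P. a < Y \<omega> \<and> Y \<omega> \<le> b}"
    by auto
  finally show ?thesis .
qed

text \<open>A difference of at least \<open>e\<close> at \<open>y\<close> persists, halved, on the whole interval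
  \<open>{y<..y + e / 2}\<close>, because the difference of two indemnities is Lipschitz with constant one.\<close>

lemma mean_square_close_imp_close:
  assumes "0 \<le> y" "0 < e"
  obtains d where "0 < d"
    "\<And>I J. I \<in> indemnities \<Longrightarrow> J \<in> indemnities \<Longrightarrow> mean_square_dist I J < d \<Longrightarrow> \<bar>I y - J y\<bar> < e"
proof
  let ?A = "{\<omega> \<in> space P. y < Y \<omega> \<and> Y \<omega> \<le> y + e / 2}"
  show "0 < (e / 2)\<^sup>2 * P.prob ?A"
    using assms prob_interval_pos[of y "y + e / 2"] by simp
  fix I J assume IJ: "I \<in> indemnities" "J \<in> indemnities"
    and small: "mean_square_dist I J < (e / 2)\<^sup>2 * P.prob ?A"
  show "\<bar>I y - J y\<bar> < e"
  proof (rule ccontr)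
    assume "\<not> \<bar>I y - J y\<bar> < e"
    then have far: "(e / 2)\<^sup>2 \<le> (I (Y \<omega>) - J (Y \<omega>))\<^sup>2" if "\<omega> \<in> ?A" for \<omega>
    proof -
      have "\<bar>I y - J y\<bar> - \<bar>I (Y \<omega>) - J (Y \<omega>)\<bar> \<le> \<bar>(I (Y \<omega>) - J (Y \<omega>)) - (I y - J y)\<bar>"
        by (rule abs_triangle_ineq2_sym)
      also have "\<dots> \<le> Y \<omega> - y"
        using that assms by (intro indemnities_diff_increment[OF IJ]) auto
      also have "\<dots> \<le> e / 2"
        using that by simp
      finally have "e / 2 \<le> \<bar>I (Y \<omega>) - J (Y \<omega>)\<bar>"
        using \<open>\<not> \<bar>I y - J y\<bar> < e\<close> by argo
      then have "(e / 2)\<^sup>2 \<le> \<bar>I (Y \<omega>) - J (Y \<omega>)\<bar>\<^sup>2"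
        using \<open>0 < e\<close> by (intro power_mono) auto
      then show ?thesis by simp
    qed
    have "(e / 2)\<^sup>2 * P.prob ?A = (\<integral>\<omega>. (e / 2)\<^sup>2 * indicator ?A \<omega> \<partial>P)"
      by simp
    also have "\<dots> \<le> mean_square_dist I J"
      unfolding mean_square_dist_def
    proof (rule integral_mono)
      show "integrable P (\<lambda>\<omega>. (e / 2)\<^sup>2 * indicator ?A \<omega>)"
        by (intro integrable_mult_right integrable_real_indicator) (auto simp: P.emeasure_eq_measure)
      show "(e / 2)\<^sup>2 * indicator ?A \<omega> \<le> (I (Y \<omega>) - J (Y \<omega>))\<^sup>2" for \<omega>
        using far[of \<omega>] by (cases "\<omega> \<in> ?A") (simp_all only: indicator_simps, auto)
    qed (rule square_diff_integrable[OF IJ])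
    finally show False using small by simp
  qed
qed

section \<open>Existence, uniqueness and continuity of the optimal indemnity\<close>

lemma optimal_unique:
  assumes "optimal t I" "optimal t J"
  shows "I = J"
proof (rule indemnities_eqI)
  show IJ: "I \<in> indemnities" "J \<in> indemnities"
    using assms by (auto simp: optimal_indemnity_def)
  have "H t I = H t J" and min: "\<And>K. K \<in> indemnities \<Longrightarrow> H t I \<le> H t K"
    using assms by (auto simp: optimal_indemnity_def intro: order_antisym)
  then have dist: "mean_square_dist I J \<le> 0"
    using near_optimal_close[OF IJ min] risk_weight_pos[of t]
    by (simp add: mult_le_0_iff)
  fix y :: real assume y: "0 \<le> y"
  have "\<bar>I y - J y\<bar> < e" if "0 < e" for e
    using mean_square_close_imp_close[OF y that] IJ dist by (metis le_less_trans)
  from this[of "\<bar>I y - J y\<bar>"] show "I y = J y"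
    by fastforce
qed

lemma objective_tendsto:
  assumes I: "\<And>k. I k \<in> indemnities" and L: "L \<in> indemnities"
    and lim: "\<And>y. 0 \<le> y \<Longrightarrow> (\<lambda>k. I k y) \<longlonglongrightarrow> L y"
  shows "(\<lambda>k. H t (I k)) \<longlonglongrightarrow> H t L"
proof -
  have bound: "\<bar>I k (Y \<omega>)\<bar> \<le> Y \<omega>" if "\<omega> \<in> space P" for k \<omega>
    using indemnities_bounds[OF I, of "Y \<omega>" k] that Y_nonneg by auto
  have limY: "(\<lambda>k. I k (Y \<omega>)) \<longlonglongrightarrow> L (Y \<omega>)" if "\<omega> \<in> space P" for \<omega>
    using that Y_nonneg by (intro lim) auto
  have "(\<lambda>k. \<integral>\<omega>. I k (Y \<omega>) \<partial>P) \<longlonglongrightarrow> (\<integral>\<omega>. L (Y \<omega>) \<partial>P)"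
    by (rule integral_dominated_convergence[where w = Y])
      (use I L bound limY Y_integrable_P in auto)
  moreover have "(\<lambda>k. \<integral>\<omega>. I k (Y \<omega>) \<partial>Q) \<longlonglongrightarrow> (\<integral>\<omega>. L (Y \<omega>) \<partial>Q)"
    by (rule integral_dominated_convergence[where w = Y])
      (use I L bound limY Y_integrable_Q indemnity_measurable_Q in \<open>auto simp: space_eq\<close>)
  moreover have "(\<lambda>k. retained_square (I k)) \<longlonglongrightarrow> retained_square L"
    unfolding retained_square_def
  proof (rule integral_dominated_convergence[where w = "\<lambda>\<omega>. (Y \<omega>)\<^sup>2"])
    show "AE \<omega> in P. (\<lambda>k. (Y \<omega> - I k (Y \<omega>))\<^sup>2) \<longlonglongrightarrow> (Y \<omega> - L (Y \<omega>))\<^sup>2"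
      by (intro AE_I2 tendsto_intros limY)
    show "AE \<omega> in P. norm ((Y \<omega> - I k (Y \<omega>))\<^sup>2) \<le> (Y \<omega>)\<^sup>2" for k
      using retained_square_le[OF I] by (intro AE_I2) simp
  qed (use I L Y_square_integrable in \<open>simp_all\<close>)
  ultimately show ?thesis
    unfolding objective_eq[OF I] objective_eq[OF L] by (intro tendsto_intros)
qed

text \<open>A minimising sequence is Cauchy at every point, so its limit can be taken along the whole
  sequence.\<close>

lemma optimal_exists: "\<exists>I. optimal t I"
proof -
  define m where "m = Inf (H t ` indemnities)"
  have bdd: "bdd_below (H t ` indemnities)"
    using objective_nonneg by (intro bdd_belowI2) auto
  have m_le: "m \<le> H t K" if "K \<in> indemnities" for K
    unfolding m_def using that bdd by (rule cINF_lower[rotated])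
  have "\<exists>I\<in>indemnities. H t I < m + inverse (Suc k)" for k
  proof -
    have "Inf (H t ` indemnities) < m + inverse (Suc k)"
      by (simp add: m_def)
    then show ?thesis
      using full_retention_indemnity bdd by (subst (asm) cInf_less_iff) auto
  qed
  then obtain I where I: "\<And>k. I k \<in> indemnities" and near: "\<And>k. H t (I k) < m + inverse (Suc k)"
    by metis
  have "Cauchy (\<lambda>k. I k y)" if "0 \<le> y" for y
  proof (rule metric_CauchyI)
    fix e :: real assume "0 < e"
    then obtain d where d: "0 < d"
      "\<And>I J. I \<in> indemnities \<Longrightarrow> J \<in> indemnities \<Longrightarrow> mean_square_dist I J < d \<Longrightarrow> \<bar>I y - J y\<bar> < e"
      using mean_square_close_imp_close[OF \<open>0 \<le> y\<close>] by metis
    \<comment> \<open>The optimality gaps of two members of the sequence then add up to less than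
      \<open>risk_weight t / 4 * d\<close>.\<close>
    then obtain N where N: "inverse (Suc N) < risk_weight t * d / 8"
      using reals_Archimedean[of "risk_weight t * d / 8"] risk_weight_pos[of t] by auto
    have "dist (I k y) (I l y) < e" if "N \<le> k" "N \<le> l" for k l
    proof -
      have "H t (I k) - m < risk_weight t * d / 8" if "N \<le> k" for k
      proof -
        have "inverse (real (Suc k)) \<le> inverse (real (Suc N))"
          using that by (intro le_imp_inverse_le) auto
        then show ?thesis
          using near[of k] N by argo
      qed
      note gap = this[OF that(1)] this[OF that(2)]
      have "risk_weight t / 4 * mean_square_dist (I k) (I l) \<le> (H t (I k) - m) + (H t (I l) - m)"
        using I I m_le by (rule near_optimal_close)
      also have "\<dots> < risk_weight t / 4 * d"
        using gap by argo
      finally have "risk_weight t / 4 * mean_square_dist (I k) (I l) < risk_weight t / 4 * d" .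
      then have "mean_square_dist (I k) (I l) < d"
        using risk_weight_pos[of t] by simp
      then show ?thesis
        using d(2)[OF I I] by (simp add: dist_real_def)
    qed
    then show "\<exists>N. \<forall>k\<ge>N. \<forall>l\<ge>N. dist (I k y) (I l y) < e"
      by blast
  qed
  then obtain L where L: "\<And>y. 0 \<le> y \<Longrightarrow> (\<lambda>k. I k y) \<longlonglongrightarrow> L y"
    unfolding Cauchy_convergent_iff convergent_def by metis
  let ?L = "\<lambda>y\<in>{0..}. L y"
  have "?L \<in> indemnities"
    using I L by (rule pointwise_limit_indemnity)
  moreover have "H t ?L \<le> m"
  proof (rule LIMSEQ_le)
    show "(\<lambda>k. H t (I k)) \<longlonglongrightarrow> H t ?L"
      using calculation I L by (intro objective_tendsto) auto
    show "(\<lambda>k. m + inverse (real (Suc k))) \<longlonglongrightarrow> m"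
      using tendsto_add[OF tendsto_const LIMSEQ_inverse_real_of_nat, of m] by simp
  qed (use less_imp_le[OF near] in auto)
  ultimately have "optimal t ?L"
    using order_trans[OF _ m_le] by (simp add: optimal_indemnity_def)
  then show ?thesis by (rule exI[where x = ?L])
qed

lemma objective_time_change:
  assumes "I \<in> indemnities"
  shows "\<bar>H t I - H s I\<bar> \<le> \<bar>risk_weight t - risk_weight s\<bar> / 2 * (\<integral>\<omega>. (Y \<omega>)\<^sup>2 \<partial>P)"
proof -
  have le: "retained_square I \<le> (\<integral>\<omega>. (Y \<omega>)\<^sup>2 \<partial>P)"
    unfolding retained_square_def
    by (rule integral_mono[OF retained_square_integrable[OF assms] Y_square_integrable])
      (rule retained_square_le[OF assms])
  have nonneg: "0 \<le> retained_square I"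
    by (simp add: retained_square_def)
  have "H t I - H s I = (risk_weight t - risk_weight s) / 2 * retained_square I"
    unfolding objective_eq[OF assms] by (simp add: field_simps)
  then have "\<bar>H t I - H s I\<bar> = \<bar>risk_weight t - risk_weight s\<bar> / 2 * retained_square I"
    by (simp only: abs_mult abs_divide abs_numeral abs_of_nonneg[OF nonneg])
  also have "\<dots> \<le> \<bar>risk_weight t - risk_weight s\<bar> / 2 * (\<integral>\<omega>. (Y \<omega>)\<^sup>2 \<partial>P)"
    using le by (intro mult_left_mono) auto
  finally show ?thesis .
qed

text \<open>The optimal indemnity for \<open>s\<close> misses the optimum for \<open>t\<close> by at most the effect of changing the
  time in both of their objectives.\<close>

lemma optimal_mean_square_dist:
  assumes "optimal s I" "optimal t J"
  shows "risk_weight t / 4 * mean_square_dist I J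
    \<le> \<bar>risk_weight t - risk_weight s\<bar> * (\<integral>\<omega>. (Y \<omega>)\<^sup>2 \<partial>P)"
proof -
  have IJ: "I \<in> indemnities" "J \<in> indemnities" and "H s I \<le> H s J"
    and min: "\<And>K. K \<in> indemnities \<Longrightarrow> H t J \<le> H t K"
    using assms by (auto simp: optimal_indemnity_def)
  then show ?thesis
    using near_optimal_close[OF IJ min] objective_time_change[OF IJ(1), of t s]
      objective_time_change[OF IJ(2), of t s] by linarith
qed

lemma optimal_continuous:
  assumes opt: "\<And>t. t \<in> S \<Longrightarrow> optimal t (I t)" and "0 \<le> y"
  shows "continuous_on S (\<lambda>t. I t y)"
  unfolding continuous_on_def
proof (intro ballI tendstoI)
  fix t and e :: real assume t: "t \<in> S" and "0 < e"
  then obtain d where d: "0 < d"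
    "\<And>I J. I \<in> indemnities \<Longrightarrow> J \<in> indemnities \<Longrightarrow> mean_square_dist I J < d \<Longrightarrow> \<bar>I y - J y\<bar> < e"
    using mean_square_close_imp_close[OF \<open>0 \<le> y\<close>] by metis
  let ?bound = "\<lambda>s. \<bar>risk_weight t - risk_weight s\<bar> * (\<integral>\<omega>. (Y \<omega>)\<^sup>2 \<partial>P)"
  have "((\<lambda>s. ?bound s) \<longlongrightarrow> ?bound t) (at t within S)"
    unfolding risk_weight_def by (intro tendsto_intros)
  moreover have "?bound t < risk_weight t / 4 * d"
    using d(1) risk_weight_pos[of t] by simp
  ultimately have "\<forall>\<^sub>F s in at t within S. ?bound s < risk_weight t / 4 * d"
    by (rule order_tendstoD)
  moreover have "\<forall>\<^sub>F s in at t within S. s \<in> S"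
    by (simp add: eventually_at_filter)
  ultimately show "\<forall>\<^sub>F s in at t within S. dist (I s y) (I t y) < e"
  proof eventually_elim
    case (elim s)
    have "risk_weight t / 4 * mean_square_dist (I s) (I t) < risk_weight t / 4 * d"
      using optimal_mean_square_dist[OF opt[OF elim(2)] opt[OF t]] elim(1) by linarith
    then have "mean_square_dist (I s) (I t) < d"
      using risk_weight_pos[of t] by simp
    then show ?case
      using d(2) opt[OF elim(2)] opt[OF t] by (simp add: optimal_indemnity_def dist_real_def)
  qed
qed

end

theorem theorem3:
  fixes P Q :: "'a measure" and Y :: "'a \<Rightarrow> real" and LR :: "real \<Rightarrow> ennreal"
    and F :: "real \<Rightarrow> real" and T r \<gamma> \<theta> :: real and n :: nat and y' :: "nat \<Rightarrow> real"
  assumes "T > 0" and "r > 0" and "\<gamma> > 0" and "\<theta> \<ge> 0"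
    and "prob_space P" and "prob_space Q" and "sets Q = sets P"
    and "Y \<in> borel_measurable P" and "\<forall>\<omega>\<in>space P. 0 \<le> Y \<omega>"
    and "integrable P Y" and "integrable P (\<lambda>\<omega>. (Y \<omega>)\<^sup>2)"
    and "integrable Q Y" and "integrable Q (\<lambda>\<omega>. (Y \<omega>)\<^sup>2)"
    and "F = cdf (distr P borel Y)"
    and "likelihood_ratio P Q Y LR"
    and "finite_variation LR"
    and "nondiff_enumeration LR F n y'"
    and "partition_condition T r \<gamma> \<theta> LR n y'"
    and "strict_mono_on {0..} F"
    and "piecewise_C1 LR"
  shows "(\<forall>t\<in>{0..T}. \<exists>!I. optimal_indemnity P Q Y T r \<gamma> \<theta> t I) \<and>
    (\<forall>Istar. (\<forall>t\<in>{0..T}. optimal_indemnity P Q Y T r \<gamma> \<theta> t (Istar t)) \<longrightarrow>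
       (\<forall>y\<ge>0. continuous_on {0..T} (\<lambda>t. Istar t y)))"
proof -
  interpret reinsurance P Q Y T r \<gamma> \<theta>
    using assms by (simp add: reinsurance_def reinsurance_axioms_def)
  show ?thesis
    using optimal_exists optimal_unique optimal_continuous by blast
qed

end
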